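(* In the setting described in the context, fix $t\in\mathbb{Z}_+$ and $\delta\in(0,1)$, and run the Adaptive Rolling Window procedure with $\delta'=\delta/(3t)$ and $M=b-a$. With probability at least $1-\delta$, its output satisfies $$|\widehat\mu_{t,\widehat k}-\mu_t|\le 3\min_{k\in[t]}\left\{3\sqrt{\log(6t/\delta)}\max_{t-k+1\le j\le t}|\mu_j-\mu_t|+\sigma_{t,k}\sqrt{\frac{2\log(6t/\delta)}{B_{t,k}}}+\frac{10(b-a)\log(6t/\delta)}{B_{t,k}}\right\}.$$
   Context: Let $a<b$ be real numbers and $t\in\mathbb{Z}_+$. For each $j\in[t]$ let $\mathcal{Q}_j$ be a probability distribution on $[a,b]$ with mean $\mu_j$ and variance $\sigma_j^2$, and let $B_j\ge 1$ be an integer. The data are $\mathcal{D}_j=\{u_{j,i}\}_{i=1}^{B_j}$, $j\in[t]$, where all $u_{j,i}$ are mutually independent and $u_{j,i}\sim\mathcal{Q}_j$. For $k\in[t]$ define $B_{t,k}=\sum_{j=t-k+1}^t B_j$, $\sigma_{t,k}^2=\frac{1}{B_{t,k}}\sum_{j=t-k+1}^t B_j\sigma_j^2$, $\widehat{\mu}_{t,k}=\frac{1}{B_{t,k}}\sum_{j=t-k+1}^t\sum_{i=1}^{B_j}u_{j,i}$, and when $B_{t,k}\ge2$, $\widehat v_{t,k}^2=\frac{1}{B_{t,k}-1}\sum_{j=t-k+1}^t\sum_{i=1}^{B_j}(u_{j,i}-\widehat\mu_{t,k})^2$ with $\widehat v_{t,k}\ge0$. For $\delta'\in(0,1)$ and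 $M>0$ define $$\widehat\psi(t,k,\delta')=\begin{cases} M, & B_{t,k}=1,\\ \widehat v_{t,k}\sqrt{\frac{2\log(2/\delta')}{B_{t,k}}}+\frac{8M\log(2/\delta')}{3(B_{t,k}-1)}, & B_{t,k}\ge 2,\end{cases}\qquad \widehat\phi(t,k,\delta')=\max_{i\in[k]}\Big(|\widehat\mu_{t,k}-\widehat\mu_{t,i}|-\big[\widehat\psi(t,k,\delta')+\widehat\psi(t,i,\delta')\big]\Big)_+ ,$$ where $x_+=\max\{x,0\}$. The Adaptive Rolling Window procedure with hyperparameters $\delta',M$ computes these quantities for all $k\in[t]$, chooses any $\widehat k\in\mathop{\mathrm{argmin}}_{k\in[t]}\{\widehat\phi(t,k,\delta')+\widehat\psi(t,k,\delta')\}$, and outputs $\widehat\mu_{t,\widehat k}$. *)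

theory Defs
  imports "HOL-Probability.Probability"
begin

text \<open>Deterministic quantities of the Adaptive Rolling Window procedure.
  Data are given as x j i (period j in {1..t}, sample i in {1..B j}).\<close>

definition Btk :: "(nat \<Rightarrow> nat) \<Rightarrow> nat \<Rightarrow> nat \<Rightarrow> nat" where
  "Btk B t k = (\<Sum>j\<in>{t-k+1..t}. B j)"

definition muhat :: "(nat \<Rightarrow> nat) \<Rightarrow> (nat \<Rightarrow> nat \<Rightarrow> real) \<Rightarrow> nat \<Rightarrow> nat \<Rightarrow> real" where
  "muhat B x t k = (\<Sum>j\<in>{t-k+1..t}. \<Sum>i\<in>{1..B j}. x j i) / real (Btk B t k)"

definition vhat :: "(nat \<Rightarrow> nat) \<Rightarrow> (nat \<Rightarrow> nat \<Rightarrow> real) \<Rightarrow> nat \<Rightarrow> nat \<Rightarrow> real" where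
  "vhat B x t k = sqrt ((\<Sum>j\<in>{t-k+1..t}. \<Sum>i\<in>{1..B j}. (x j i - muhat B x t k)\<^sup>2)
                      / (real (Btk B t k) - 1))"

definition psihat :: "(nat \<Rightarrow> nat) \<Rightarrow> (nat \<Rightarrow> nat \<Rightarrow> real) \<Rightarrow> real \<Rightarrow> real \<Rightarrow> nat \<Rightarrow> nat \<Rightarrow> real" where
  "psihat B x \<delta>' M t k =
     (if Btk B t k = 1 then M
      else vhat B x t k * sqrt (2 * ln (2 / \<delta>') / real (Btk B t k))
           + 8 * M * ln (2 / \<delta>') / (3 * (real (Btk B t k) - 1)))"

definition phihat :: "(nat \<Rightarrow> nat) \<Rightarrow> (nat \<Rightarrow> nat \<Rightarrow> real) \<Rightarrow> real \<Rightarrow> real \<Rightarrow> nat \<Rightarrow> nat \<Rightarrow> real" where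
  "phihat B x \<delta>' M t k =
     Max ((\<lambda>i. max 0 (\<bar>muhat B x t k - muhat B x t i\<bar>
                       - (psihat B x \<delta>' M t k + psihat B x \<delta>' M t i))) ` {1..k})"

definition arw_argmin :: "(nat \<Rightarrow> nat) \<Rightarrow> (nat \<Rightarrow> nat \<Rightarrow> real) \<Rightarrow> real \<Rightarrow> real \<Rightarrow> nat \<Rightarrow> nat set" where
  "arw_argmin B x \<delta>' M t =
     {k \<in> {1..t}. \<forall>k'\<in>{1..t}.
        phihat B x \<delta>' M t k + psihat B x \<delta>' M t k
        \<le> phihat B x \<delta>' M t k' + psihat B x \<delta>' M t k'}"

text \<open>Population quantities: sigma_{t,k}^2 from per-period variances s2 j.\<close>
definition sigma2tk :: "(nat \<Rightarrow> nat) \<Rightarrow> (nat \<Rightarrow> real) \<Rightarrow> nat \<Rightarrow> nat \<Rightarrow> real" where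
  "sigma2tk B s2 t k = (\<Sum>j\<in>{t-k+1..t}. real (B j) * s2 j) / real (Btk B t k)"

end

theory Submission
  imports Defs
begin

text \<open>
  Four tail bounds of level \<open>exp (- L)\<close> per window suffice, less than the six units that the
  choice of \<open>\<delta>'\<close> pays for: Bernstein's inequality for both tails of the pooled
  mean, and an upper and a lower tail for the sum of squared deviations from the \<^emph>\<open>expected\<close>
  pooled mean, which differs from the empirical sum of squares only by the squared error of the
  pooled mean. The constant 8/3 leaves room for an error of 7/6 in the comparison of the standard
  deviation with its empirical version; that constant is reached without the entropy method because
  a large variance forces the pooled mean away from the endpoints, which shrinks the range of the
  squared deviations. On the resulting event, comparing the selected window with any fixed one as in
  Lepski's method gives the oracle inequality.
\<close>

section \<open>Scalar bounds on the exponential\<close>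

text \<open>Since \<open>2 * 3 ^ n \<le> fact (n + 2)\<close>, the exponential series from the
  quadratic term on is dominated by a geometric series of ratio \<open>w / 3\<close>. This is the
  source of the scale \<open>b / 3\<close> in Bernstein's inequality.\<close>

lemma exp_le_sub_gamma:
  fixes z w :: real
  assumes "\<bar>z\<bar> \<le> w" "w < 3"
  shows "exp z \<le> 1 + z + z\<^sup>2 / (2 * (1 - w / 3))"
proof -
  have w: "0 \<le> w" using assms by linarith
  have fact_ge: "2 * 3 ^ n \<le> (fact (n + 2) :: real)" for n
  proof (induction n)
    case (Suc n)
    have "2 * 3 ^ Suc n \<le> 3 * (fact (n + 2) :: real)" using Suc.IH by (simp only: power_Suc)
    also have "\<dots> \<le> (real n + 3) * fact (n + 2)" by (intro mult_right_mono) auto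
    also have "\<dots> = fact (Suc n + 2)" by (simp add: algebra_simps)
    finally show ?case .
  qed (simp add: fact_numeral)
  have s1: "(\<lambda>n. z ^ n /\<^sub>R fact n) sums exp z" by (rule exp_converges)
  have "(\<lambda>n. z ^ (n + 2) /\<^sub>R fact (n + 2)) sums (exp z - (\<Sum>n<2. z ^ n /\<^sub>R fact n))"
    using sums_split_initial_segment[OF s1, of 2] by simp
  then have s2: "(\<lambda>n. z ^ (n + 2) /\<^sub>R fact (n + 2)) sums (exp z - (1 + z))"
    by (simp add: numeral_2_eq_2)
  have "(\<lambda>n. z\<^sup>2 / 2 * (w / 3) ^ n) sums (z\<^sup>2 / 2 * (1 / (1 - w / 3)))"
    using assms w by (intro sums_mult geometric_sums) auto
  then have s3: "(\<lambda>n. z\<^sup>2 / 2 * (w / 3) ^ n) sums (z\<^sup>2 / (2 * (1 - w / 3)))"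
    by simp
  have "z ^ (n + 2) /\<^sub>R fact (n + 2) \<le> z\<^sup>2 / 2 * (w / 3) ^ n" for n
  proof -
    have "z ^ (n + 2) / fact (n + 2) \<le> \<bar>z\<bar> ^ (n + 2) / fact (n + 2)"
      by (intro divide_right_mono) (metis abs_ge_self power_abs, simp)
    also have "\<dots> \<le> \<bar>z\<bar> ^ (n + 2) / (2 * 3 ^ n)"
      using fact_ge[of n] by (intro divide_left_mono) (auto intro!: mult_pos_pos)
    also have "\<dots> = z\<^sup>2 / 2 * (\<bar>z\<bar> / 3) ^ n"
      by (simp add: power_add power_divide power2_eq_square)
    also have "\<dots> \<le> z\<^sup>2 / 2 * (w / 3) ^ n"
      using assms by (intro mult_left_mono power_mono divide_right_mono) auto
    finally show ?thesis by (simp only: real_scaleR_def divide_inverse_commute)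
  qed
  from sums_le[OF this s2 s3] show ?thesis by simp
qed

text \<open>The difference of the two sides vanishes at zero and has the nonnegative derivative
  \<open>x - 1 + exp (- x)\<close>. There is no upper limit on \<open>z\<close>, which is why lower
  tails of nonnegative variables get no term linear in \<open>L\<close>.\<close>

lemma exp_minus_le_quadratic:
  fixes z :: real
  assumes "0 \<le> z"
  shows "exp (- z) \<le> 1 - z + z\<^sup>2 / 2"
proof -
  let ?f = "\<lambda>z::real. 1 - z + z\<^sup>2 / 2 - exp (- z)"
  have "?f 0 \<le> ?f z"
  proof (rule DERIV_nonneg_imp_nondecreasing[OF assms])
    fix x :: real assume "0 \<le> x" "x \<le> z"
    have "(?f has_real_derivative (x - 1 + exp (- x))) (at x)"
      by (auto intro!: derivative_eq_intros)
    moreover have "0 \<le> x - 1 + exp (- x)" using exp_ge_add_one_self[of "- x"] by simp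
    ultimately show "\<exists>y. (?f has_real_derivative y) (at x) \<and> 0 \<le> y" by blast
  qed
  then show ?thesis by simp
qed

section \<open>Tail bounds for independent sums\<close>

context prob_space
begin

text \<open>Chernoff's method for two regimes at once: \<open>c > 0\<close> is Bernstein's,
  \<open>c = 0\<close> the sub-Gaussian one. For \<open>v = c = 0\<close> the threshold is zero and
  vanishing summands would violate the claim; \<open>pos\<close> excludes this.\<close>

lemma sub_gamma_sum_tail:
  fixes X :: "'i \<Rightarrow> 'a \<Rightarrow> real"
  assumes fin: "finite I"
    and indep: "indep_vars (\<lambda>_. borel) X I"
    and int: "\<And>i l. i \<in> I \<Longrightarrow> integrable M (\<lambda>x. exp (l * X i x))"
    and mgf: "\<And>i l. i \<in> I \<Longrightarrow> 0 \<le> l \<Longrightarrow> c * l < 1 \<Longrightarrow>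
      expectation (\<lambda>x. exp (l * X i x)) \<le> exp (w i * l\<^sup>2 / (2 * (1 - c * l)))"
    and c: "0 \<le> c" and wv: "(\<Sum>i\<in>I. w i) \<le> v" and v: "0 \<le> v" and pos: "0 < v \<or> 0 < c"
    and L: "0 < L"
  shows "prob {x \<in> space M. (\<Sum>i\<in>I. X i x) \<ge> sqrt (2 * v * L) + c * L} \<le> exp (- L)"
    (is "prob ?E \<le> _")
proof -
  have [measurable]: "i \<in> I \<Longrightarrow> random_variable borel (X i)" for i
    using indep unfolding indep_vars_def by blast
  define t where "t = sqrt (2 * v * L) + c * L"
  have chernoff: "prob ?E \<le> exp (v * l\<^sup>2 / (2 * (1 - c * l)) - l * t)"
    if l: "0 < l" "c * l < 1" for l
  proof -
    have ind: "indep_vars (\<lambda>_. borel) (\<lambda>i x. exp (l * X i x)) I"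
      by (rule indep_vars_compose2[OF indep]) auto
    have eq: "(\<lambda>x. exp (l * (\<Sum>i\<in>I. X i x))) = (\<lambda>x. \<Prod>i\<in>I. exp (l * X i x))"
      by (simp add: sum_distrib_left exp_sum fin)
    have ii: "integrable M (\<lambda>x. exp (l * (\<Sum>i\<in>I. X i x)))"
      unfolding eq by (rule indep_vars_integrable[OF fin ind int])
    have "?E = {x \<in> space M. exp (l * (\<Sum>i\<in>I. X i x)) \<ge> exp (l * t)}"
      using l by (auto simp: t_def)
    also have "prob \<dots> \<le> expectation (\<lambda>x. exp (l * (\<Sum>i\<in>I. X i x))) / exp (l * t)"
      by (rule integral_Markov_inequality_measure[OF ii, where A = "space M"]) auto
    also have "expectation (\<lambda>x. exp (l * (\<Sum>i\<in>I. X i x))) = (\<Prod>i\<in>I. expectation (\<lambda>x. exp (l * X i x)))"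
      unfolding eq by (rule indep_vars_lebesgue_integral[OF fin ind int])
    also have "\<dots> \<le> (\<Prod>i\<in>I. exp (w i * l\<^sup>2 / (2 * (1 - c * l))))"
      using l mgf[of _ l] by (intro prod_mono) auto
    also have "\<dots> = exp ((\<Sum>i\<in>I. w i) * l\<^sup>2 / (2 * (1 - c * l)))"
      by (simp add: exp_sum fin sum_distrib_right sum_divide_distrib)
    also have "\<dots> \<le> exp (v * l\<^sup>2 / (2 * (1 - c * l)))"
      using l wv by (auto intro!: divide_right_mono mult_right_mono)
    finally show ?thesis by (simp add: exp_diff divide_right_mono)
  qed
  show ?thesis
  proof (cases "v = 0")
    case True
    then have c0: "0 < c" using pos by simp
    \<comment> \<open>With \<open>v = 0\<close> the exponent improves up to the excluded endpoint
      \<open>l = 1 / c\<close>; so \<open>l = z / c\<close> is used and \<open>z\<close> tends to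
      one from the left.\<close>
    have *: "prob ?E \<le> exp (- z * L)" if "0 < z" "z < 1" for z
      using chernoff[of "z / c"] that c0 True by (simp add: t_def)
    have "((\<lambda>z. exp (- z * L)) \<longlongrightarrow> exp (- 1 * L)) (at_left 1)"
      by (intro tendsto_intros)
    moreover have "eventually (\<lambda>z. prob ?E \<le> exp (- z * L)) (at_left 1)"
      using eventually_at_left_real[OF zero_less_one] by (rule eventually_mono) (use * in auto)
    ultimately have "prob ?E \<le> exp (- 1 * L)"
      by (rule tendsto_lowerbound) simp
    then show ?thesis by simp
  next
    case False
    then have v0: "0 < v" using v by simp
    \<comment> \<open>With this \<open>g\<close>, the parameter \<open>l = g / (1 + c * g)\<close>
      minimises the Chernoff exponent, and the minimum is exactly \<open>- L\<close> because
      \<open>t = v * g + c * L\<close>.\<close>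
    define g where "g = sqrt (2 * L / v)"
    have g0: "0 < g" and g2: "g\<^sup>2 = 2 * L / v" using L v0 by (auto simp: g_def)
    have cg: "0 < 1 + c * g" using c g0 by (simp add: add_pos_nonneg)
    have tg: "t = v * g + c * L"
    proof -
      have "(v * g)\<^sup>2 = 2 * v * L"
        unfolding power_mult_distrib g2 using v0 by (simp add: power2_eq_square)
      then have "sqrt (2 * v * L) = v * g"
        using g0 v0 by (intro real_sqrt_unique) auto
      then show ?thesis by (simp add: t_def)
    qed
    define l where "l = g / (1 + c * g)"
    have l: "0 < l" "1 - c * l = 1 / (1 + c * g)"
      using g0 cg by (auto simp: l_def field_simps)
    then have "c * l < 1" using cg by (smt (verit) divide_pos_pos)
    have "v * l\<^sup>2 / (2 * (1 - c * l)) - l * t = (v * g\<^sup>2 / 2 - g * t) / (1 + c * g)"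
    proof -
      have "v * l\<^sup>2 / (2 * (1 - c * l)) = v * l\<^sup>2 * (1 + c * g) / 2"
        unfolding l(2) by simp
      also have "\<dots> = v * g\<^sup>2 / 2 / (1 + c * g)"
        using cg by (simp add: l_def power2_eq_square)
      finally show ?thesis by (simp add: l_def diff_divide_distrib)
    qed
    also have "v * g\<^sup>2 / 2 - g * t = - L * (1 + c * g)"
    proof -
      have "v * g\<^sup>2 = 2 * L" using g2 v0 by simp
      then show ?thesis unfolding tg by (simp add: algebra_simps power2_eq_square)
    qed
    finally have "v * l\<^sup>2 / (2 * (1 - c * l)) - l * t = - L" using cg by simp
    with chernoff[OF l(1) \<open>c * l < 1\<close>] show ?thesis by simp
  qed
qed

lemma integrable_exp_of_AE_abs_le:
  fixes X :: "'a \<Rightarrow> real"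
  assumes [measurable]: "random_variable borel X" and bd: "AE x in M. \<bar>X x\<bar> \<le> b"
  shows "integrable M (\<lambda>x. exp (l * X x))"
proof (rule integrable_const_bound)
  show "AE x in M. norm (exp (l * X x)) \<le> exp (\<bar>l\<bar> * b)"
    using bd
  proof eventually_elim
    case (elim x)
    have "l * X x \<le> \<bar>l\<bar> * \<bar>X x\<bar>" by (metis abs_ge_self abs_mult)
    also have "\<dots> \<le> \<bar>l\<bar> * b" using elim by (intro mult_left_mono) auto
    finally show ?case by simp
  qed
qed simp

lemma bernstein_ineq:
  fixes X :: "'i \<Rightarrow> 'a \<Rightarrow> real"
  assumes fin: "finite I"
    and indep: "indep_vars (\<lambda>_. borel) X I"
    and bd: "\<And>i. i \<in> I \<Longrightarrow> AE x in M. \<bar>X i x\<bar> \<le> b"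
    and mean: "\<And>i. i \<in> I \<Longrightarrow> expectation (X i) = 0"
    and var: "(\<Sum>i\<in>I. expectation (\<lambda>x. (X i x)\<^sup>2)) \<le> v"
    and b: "0 < b" and L: "0 < L"
  shows "prob {x \<in> space M. (\<Sum>i\<in>I. X i x) \<ge> sqrt (2 * v * L) + b * L / 3} \<le> exp (- L)"
proof -
  have rv: "random_variable borel (X i)" if "i \<in> I" for i
    using indep that unfolding indep_vars_def by blast
  have mgf: "expectation (\<lambda>x. exp (l * X i x))
      \<le> exp (expectation (\<lambda>x. (X i x)\<^sup>2) * l\<^sup>2 / (2 * (1 - b / 3 * l)))"
    if i: "i \<in> I" and l: "0 \<le> l" "b / 3 * l < 1" for i l
  proof -
    note [measurable] = rv[OF i]
    let ?d = "2 * (1 - b / 3 * l)"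
    have i1: "integrable M (X i)" by (rule integrable_const_bound[where B = b]) (use bd[OF i] in auto)
    have i2: "integrable M (\<lambda>x. (X i x)\<^sup>2)"
    proof (rule integrable_const_bound[where B = "b\<^sup>2"])
      show "AE x in M. norm ((X i x)\<^sup>2) \<le> b\<^sup>2"
        using bd[OF i] by eventually_elim (use b in \<open>simp add: abs_le_square_iff[symmetric]\<close>)
    qed simp
    have "expectation (\<lambda>x. exp (l * X i x)) \<le> expectation (\<lambda>x. 1 + l * X i x + l\<^sup>2 / ?d * (X i x)\<^sup>2)"
    proof (rule integral_mono_AE)
      show "AE x in M. exp (l * X i x) \<le> 1 + l * X i x + l\<^sup>2 / ?d * (X i x)\<^sup>2"
        using bd[OF i]
      proof eventually_elim
        case (elim x)
        have "\<bar>l * X i x\<bar> \<le> l * b" using elim l by (simp add: abs_mult mult_left_mono)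
        from exp_le_sub_gamma[OF this] l show ?case
          by (simp add: power_mult_distrib mult.commute)
      qed
    qed (use i1 i2 in \<open>auto intro!: integrable_exp_of_AE_abs_le bd[OF i]\<close>)
    also have "\<dots> = 1 + l\<^sup>2 / ?d * expectation (\<lambda>x. (X i x)\<^sup>2)"
      using i1 i2 mean[OF i] by (simp add: prob_space)
    also have "\<dots> \<le> exp (l\<^sup>2 / ?d * expectation (\<lambda>x. (X i x)\<^sup>2))" by (rule exp_ge_add_one_self)
    finally show ?thesis by (simp add: mult.commute)
  qed
  have "0 \<le> (\<Sum>i\<in>I. expectation (\<lambda>x. (X i x)\<^sup>2))" by (intro sum_nonneg) simp
  then have "0 \<le> v" using var by linarith
  from sub_gamma_sum_tail[OF fin indep _ mgf _ var this _ L] b rv bd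
  show ?thesis by (auto intro: integrable_exp_of_AE_abs_le)
qed

text \<open>Bounding the square of \<open>Y i x\<close> by \<open>K * Y i x\<close> turns the second
  moment into \<open>K\<close> times the mean. The centred negatives are therefore sub-Gaussian for
  \<open>l \<ge> 0\<close>, with total variance factor \<open>K * S\<close>, and the sum tail
  applies with \<open>c = 0\<close>.\<close>

lemma nonneg_sum_lower_tail:
  fixes Y :: "'i \<Rightarrow> 'a \<Rightarrow> real"
  assumes fin: "finite I"
    and indep: "indep_vars (\<lambda>_. borel) Y I"
    and bd: "\<And>i. i \<in> I \<Longrightarrow> AE x in M. 0 \<le> Y i x \<and> Y i x \<le> K"
    and S: "S = (\<Sum>i\<in>I. expectation (Y i))"
    and pos: "0 < S" "0 < K" "0 < L"
  shows "prob {x \<in> space M. (\<Sum>i\<in>I. Y i x) \<le> S - sqrt (2 * (K * S) * L)} \<le> exp (- L)"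
proof -
  let ?X = "\<lambda>i x. expectation (Y i) - Y i x"
  have rv: "random_variable borel (Y i)" if "i \<in> I" for i
    using indep that unfolding indep_vars_def by blast
  have ie: "integrable M (\<lambda>x. exp (l * Y i x))" if i: "i \<in> I" for i l
  proof (rule integrable_exp_of_AE_abs_le[OF rv[OF i]])
    show "AE x in M. \<bar>Y i x\<bar> \<le> K" using bd[OF i] by eventually_elim auto
  qed
  have eq: "exp (l * ?X i x) = exp (l * expectation (Y i)) * exp (- l * Y i x)" for i l x
    by (simp add: algebra_simps flip: exp_add)
  have mgf: "expectation (\<lambda>x. exp (l * ?X i x))
      \<le> exp (K * expectation (Y i) * l\<^sup>2 / (2 * (1 - 0 * l)))"
    if i: "i \<in> I" and l: "0 \<le> l" for i l
  proof -
    note [measurable] = rv[OF i]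
    let ?m = "expectation (Y i)"
    have i1: "integrable M (Y i)"
      by (rule integrable_const_bound[where B = K]) (use bd[OF i] in auto)
    have "expectation (\<lambda>x. exp (- l * Y i x)) \<le> expectation (\<lambda>x. 1 - l * Y i x + l\<^sup>2 / 2 * K * Y i x)"
    proof (rule integral_mono_AE)
      show "AE x in M. exp (- l * Y i x) \<le> 1 - l * Y i x + l\<^sup>2 / 2 * K * Y i x"
        using bd[OF i]
      proof eventually_elim
        case (elim x)
        have "exp (- l * Y i x) \<le> 1 - l * Y i x + (l * Y i x)\<^sup>2 / 2"
          using exp_minus_le_quadratic[of "l * Y i x"] l elim by simp
        also have "(l * Y i x)\<^sup>2 / 2 = l\<^sup>2 / 2 * (Y i x * Y i x)"
          by (simp add: power2_eq_square)
        also have "\<dots> \<le> l\<^sup>2 / 2 * (K * Y i x)"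
          using elim by (intro mult_left_mono mult_right_mono) auto
        finally show ?case by simp
      qed
    qed (use i1 ie[OF i, of "- l"] in auto)
    also have "\<dots> = 1 + (- l * ?m + K * ?m * l\<^sup>2 / 2)"
      using i1 by (simp add: prob_space algebra_simps)
    also have "\<dots> \<le> exp (- l * ?m + K * ?m * l\<^sup>2 / 2)" by (rule exp_ge_add_one_self)
    finally have "exp (l * ?m) * expectation (\<lambda>x. exp (- l * Y i x))
        \<le> exp (l * ?m) * exp (- l * ?m + K * ?m * l\<^sup>2 / 2)"
      by (intro mult_left_mono) auto
    then have "exp (l * ?m) * expectation (\<lambda>x. exp (- l * Y i x)) \<le> exp (K * ?m * l\<^sup>2 / 2)"
      by (simp flip: exp_add)
    then show ?thesis unfolding eq by simp
  qed
  have ind: "indep_vars (\<lambda>_. borel) ?X I"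
    by (rule indep_vars_compose2[OF indep, of "\<lambda>i y. expectation (Y i) - y"]) auto
  have "integrable M (\<lambda>x. exp (l * ?X i x))" if "i \<in> I" for i l
    unfolding eq using ie[OF that, of "- l"] by simp
  moreover have "(\<Sum>i\<in>I. K * expectation (Y i)) \<le> K * S" by (simp add: S sum_distrib_left)
  moreover have "0 < K * S" using pos by simp
  ultimately have "prob {x \<in> space M. (\<Sum>i\<in>I. ?X i x) \<ge> sqrt (2 * (K * S) * L) + 0 * L} \<le> exp (- L)"
    using pos mgf by (intro sub_gamma_sum_tail[OF fin ind, where w = "\<lambda>i. K * expectation (Y i)"]) auto
  moreover have "(\<Sum>i\<in>I. ?X i x) = S - (\<Sum>i\<in>I. Y i x)" for x
    by (simp add: S sum_subtractf)
  ultimately show ?thesis by (simp add: le_diff_eq add.commute)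
qed

end

section \<open>Deterministic comparison of true and empirical spread\<close>

text \<open>
  Here \<open>\<sigma>\<^sup>2\<close> is the average variance, \<open>\<tau>\<^sup>2\<close> the average second moment about the pooled
  mean, \<open>q\<close> the larger distance of the pooled mean to an endpoint of the range of length \<open>c\<close>,
  \<open>d\<close> the error of the empirical mean, \<open>v\<close> the empirical standard deviation, and
  \<open>\<rho>\<^sup>2 = 2 L / n\<close>. With \<open>c\<close> in place of \<open>q\<close> in the last hypothesis the constant 7/6 would fail.
\<close>
lemma std_le_empirical_std:
  fixes c q v d \<sigma> \<tau> \<rho> :: real
  assumes c: "0 < c" and q: "q \<le> c" and \<rho>: "0 \<le> \<rho>" and v: "0 \<le> v" and d: "0 \<le> d"
    and \<sigma>: "0 \<le> \<sigma>" "\<sigma> \<le> \<tau>" and \<tau>: "\<tau>\<^sup>2 \<le> q * (c - q)"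
    and dle: "d \<le> \<sigma> * \<rho> + c * \<rho>\<^sup>2 / 6"
    and vge: "\<tau>\<^sup>2 - q * \<tau> * \<rho> - d\<^sup>2 \<le> v\<^sup>2"
  shows "\<sigma> \<le> v + 7 / 6 * c * \<rho>"
proof -
  text \<open>Homogeneity reduces the claim to \<open>c = 1\<close>.\<close>
  have unit: "s \<le> v + 7 / 6 * \<rho>"
    if q: "q \<le> 1" and v: "0 \<le> v" and d: "0 \<le> d" and s: "0 \<le> s" "s \<le> \<tau>" and \<tau>: "\<tau>\<^sup>2 \<le> q * (1 - q)"
      and dle: "d \<le> s * \<rho> + \<rho>\<^sup>2 / 6" and vge: "\<tau>\<^sup>2 - q * \<tau> * \<rho> - d\<^sup>2 \<le> v\<^sup>2"
    for q v d s \<tau> :: real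
  proof (rule ccontr)
    assume "\<not> ?thesis"
    \<comment> \<open>The negated claim forces \<open>\<rho> < 6 / 7 * s\<close>, so every error
      term below can be measured against \<open>s\<close>.\<close>
    then have gt: "v < s - 7 / 6 * \<rho>" by simp
    then have s\<rho>: "7 / 6 * \<rho> < s" using v by linarith
    have s0: "0 < s" using s\<rho> \<rho> by linarith
    \<comment> \<open>Here a large second moment shrinks the range: \<open>q\<close> gives way to
      \<open>1 - \<tau>\<^sup>2\<close>, and the resulting \<open>s ^ 3\<close> later absorbs most
      of the bound on \<open>d\<^sup>2\<close>.\<close>
    have "q * (1 - q) \<le> 1 - q"
      using mult_right_mono[of q 1 "1 - q"] q by simp
    with \<tau> have q1: "q \<le> 1 - \<tau>\<^sup>2" by linarith
    have "\<tau>\<^sup>2 \<le> 1 / 4"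
    proof -
      have "q * (1 - q) = 1 / 4 - (q - 1 / 2)\<^sup>2" by (simp add: power2_eq_square algebra_simps)
      then show ?thesis using \<tau> zero_le_power2[of "q - 1 / 2"] by linarith
    qed
    then have s14: "s\<^sup>2 \<le> 1 / 4" using s power_mono[of s \<tau> 2] by linarith
    have "q * \<tau> * \<rho> \<le> (1 - \<tau>\<^sup>2) * \<tau> * \<rho>"
      using q1 \<rho> s by (intro mult_right_mono) auto
    then have 1: "\<tau>\<^sup>2 - (1 - \<tau>\<^sup>2) * \<tau> * \<rho> - d\<^sup>2 \<le> v\<^sup>2" using vge by linarith
    \<comment> \<open>Monotonicity between \<open>s\<close> and \<open>\<tau>\<close>: the
      difference has the factor \<open>\<tau> - s\<close>, and the cofactor is nonnegative because
      \<open>\<rho> < s\<close>.\<close>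
    have 2: "s\<^sup>2 - (1 - s\<^sup>2) * s * \<rho> \<le> \<tau>\<^sup>2 - (1 - \<tau>\<^sup>2) * \<tau> * \<rho>"
    proof -
      have "0 \<le> (\<tau> - s) * (\<tau> + s - \<rho> + \<rho> * (\<tau>\<^sup>2 + \<tau> * s + s\<^sup>2))"
        using s \<rho> s\<rho> by (intro mult_nonneg_nonneg add_nonneg_nonneg) auto
      also have "\<dots> = (\<tau>\<^sup>2 - (1 - \<tau>\<^sup>2) * \<tau> * \<rho>) - (s\<^sup>2 - (1 - s\<^sup>2) * s * \<rho>)"
        by (simp add: power2_eq_square algebra_simps)
      finally show ?thesis by simp
    qed
    \<comment> \<open>The constant is the square of \<open>8 / 7 = 1 + 1 / 7\<close>, as
      \<open>\<rho> / 6 < s / 7\<close>.\<close>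
    have 3: "d\<^sup>2 \<le> 64 / 49 * s\<^sup>2 * \<rho>\<^sup>2"
    proof -
      have "d \<le> (s + \<rho> / 6) * \<rho>" using dle by (simp add: power2_eq_square algebra_simps)
      also have "\<dots> \<le> (8 / 7 * s) * \<rho>" using s\<rho> \<rho> by (intro mult_right_mono) auto
      finally have "d\<^sup>2 \<le> (8 / 7 * s * \<rho>)\<^sup>2" using d by (intro power_mono) auto
      also have "\<dots> = 64 / 49 * s\<^sup>2 * \<rho>\<^sup>2" by (simp add: power2_eq_square)
      finally show ?thesis .
    qed
    have 4: "v\<^sup>2 < (s - 7 / 6 * \<rho>)\<^sup>2" using gt v by (intro power_strict_mono) auto
    have "s\<^sup>2 - (1 - s\<^sup>2) * s * \<rho> - 64 / 49 * s\<^sup>2 * \<rho>\<^sup>2 < (s - 7 / 6 * \<rho>)\<^sup>2"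
      using 1 2 3 4 by linarith
    \<comment> \<open>After \<open>s\<^sup>2\<close> cancels, a factor \<open>\<rho>\<close> splits
      off. Of \<open>4 / 3 * s\<close> in the bracket, \<open>7 / 6 * s\<close> pays for
      \<open>49 / 36 * \<rho>\<close>; the remaining \<open>s / 6\<close> together with
      \<open>s ^ 3\<close> pays for the last term.\<close>
    then have "\<rho> * (4 / 3 * s + s ^ 3 - 49 / 36 * \<rho> - 64 / 49 * s\<^sup>2 * \<rho>) < 0"
      by (simp add: power2_eq_square power3_eq_cube algebra_simps)
    moreover have "49 / 36 * \<rho> \<le> 7 / 6 * s" using s\<rho> by simp
    moreover have "64 / 49 * s\<^sup>2 * \<rho> \<le> s ^ 3 + s / 6"
    proof -
      have "64 / 49 * s\<^sup>2 * \<rho> \<le> 64 / 49 * s\<^sup>2 * (6 / 7 * s)"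
        using s\<rho> by (intro mult_left_mono) auto
      also have "\<dots> = s ^ 3 + (41 / 343 * s\<^sup>2) * s" by (simp add: power2_eq_square power3_eq_cube)
      also have "\<dots> \<le> s ^ 3 + (1 / 6) * s"
        using s14 s0 by (intro add_left_mono mult_right_mono) auto
      finally show ?thesis by simp
    qed
    ultimately show False using \<rho> mult_nonneg_nonneg[OF \<rho>, of "4 / 3 * s + s ^ 3 - 49 / 36 * \<rho> - 64 / 49 * s\<^sup>2 * \<rho>"]
      by linarith
  qed
  have "\<sigma> / c \<le> v / c + 7 / 6 * \<rho>"
  proof (rule unit)
    show "q / c \<le> 1" "0 \<le> v / c" "0 \<le> d / c" "0 \<le> \<sigma> / c" "\<sigma> / c \<le> \<tau> / c"
      using q c v d \<sigma> by (auto simp: divide_right_mono)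
    have "(\<tau> / c)\<^sup>2 \<le> q * (c - q) / c\<^sup>2"
      unfolding power_divide using \<tau> by (intro divide_right_mono) auto
    then show "(\<tau> / c)\<^sup>2 \<le> q / c * (1 - q / c)"
      using c by (simp add: field_simps power2_eq_square)
    have "d / c \<le> (\<sigma> * \<rho> + c * \<rho>\<^sup>2 / 6) / c"
      using dle c by (intro divide_right_mono) auto
    then show "d / c \<le> \<sigma> / c * \<rho> + \<rho>\<^sup>2 / 6"
      using c by (simp add: add_divide_distrib)
    have "(\<tau>\<^sup>2 - q * \<tau> * \<rho> - d\<^sup>2) / c\<^sup>2 \<le> v\<^sup>2 / c\<^sup>2"
      using vge by (intro divide_right_mono) auto
    then show "(\<tau> / c)\<^sup>2 - q / c * (\<tau> / c) * \<rho> - (d / c)\<^sup>2 \<le> (v / c)\<^sup>2"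
      by (simp add: power_divide diff_divide_distrib power2_eq_square)
  qed
  then show ?thesis using c by (simp add: field_simps)
qed

text \<open>The price of a window: bias plus data-driven radius against the oracle term. In the
  budget, \<open>sqrt L * \<Delta>\<close> is used \<open>1 + 3 / 2 \<le> 3\<close> times and
  \<open>c * L / n\<close> is used \<open>5 / 2 + 16 / 3 \<le> 10\<close> times, the 16/3 coming
  from \<open>n - 1 \<ge> n / 2\<close>.\<close>

lemma empirical_bernstein_radius_le:
  fixes n c v \<sigma> \<tau> \<rho> \<Delta> L :: real
  assumes n: "2 \<le> n" and c: "0 < c" and L: "1 \<le> L" and \<rho>: "\<rho> = sqrt (2 * L / n)"
    and v: "(n - 1) * v\<^sup>2 \<le> n * (\<tau> + c * \<rho> / 2)\<^sup>2" and \<sigma>: "0 \<le> \<sigma>" "\<sigma> \<le> c" and \<Delta>: "0 \<le> \<Delta>"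
    and \<tau>: "0 \<le> \<tau>" "\<tau> \<le> \<sigma> + \<Delta>"
  shows "\<Delta> + (v * \<rho> + 8 * c * L / (3 * (n - 1)))
    \<le> 3 * sqrt L * \<Delta> + \<sigma> * \<rho> + 10 * c * L / n"
proof -
  have \<rho>2: "\<rho>\<^sup>2 = 2 * L / n" and \<rho>0: "0 \<le> \<rho>" using \<rho> n L by auto
  have "2 * L / n \<le> L" using n L by (simp add: divide_simps)
  then have \<rho>s: "\<rho> \<le> sqrt L" unfolding \<rho> by simp
  have sL: "1 \<le> sqrt L" "sqrt L \<le> L"
    using L by (auto intro!: real_le_lsqrt simp: power2_eq_square)
  \<comment> \<open>A rational upper bound for \<open>sqrt (n / (n - 1))\<close>, valid from
    \<open>n = 2\<close> on.\<close>
  define x where "x = 1 + 1 / n"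
  have x: "1 \<le> x" "x \<le> 3 / 2" using n by (auto simp: x_def divide_simps)
  have "n \<le> (n - 1) * x\<^sup>2"
  proof -
    have "n + 1 \<le> n * n" using n mult_right_mono[of 2 n n] by linarith
    then show ?thesis
      using n unfolding x_def by (simp add: divide_simps power2_eq_square) (simp add: algebra_simps)
  qed
  then have "n * (\<tau> + c * \<rho> / 2)\<^sup>2 \<le> (n - 1) * x\<^sup>2 * (\<tau> + c * \<rho> / 2)\<^sup>2"
    by (intro mult_right_mono) auto
  with v have "(n - 1) * v\<^sup>2 \<le> (n - 1) * (x * (\<tau> + c * \<rho> / 2))\<^sup>2"
    by (simp add: power_mult_distrib mult.assoc)
  then have "v\<^sup>2 \<le> (x * (\<tau> + c * \<rho> / 2))\<^sup>2" using n by simp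
  moreover have "0 \<le> x * (\<tau> + c * \<rho> / 2)" using x \<tau> c \<rho>0 by simp
  ultimately have "v \<le> x * (\<tau> + c * \<rho> / 2)" by (rule power2_le_imp_le)
  also have "\<dots> \<le> x * (\<sigma> + \<Delta> + c * \<rho> / 2)" using x \<tau> by (intro mult_left_mono) auto
  finally have "v * \<rho> \<le> x * (\<sigma> + \<Delta> + c * \<rho> / 2) * \<rho>" using \<rho>0 by (intro mult_right_mono) auto
  \<comment> \<open>Splitting \<open>x\<close> as \<open>1 + 1 / n\<close> on the
    \<open>\<sigma>\<close> term keeps coefficient one on the leading
    \<open>\<sigma> * \<rho>\<close>; the excess is at most \<open>c * L / n\<close>.\<close>
  also have "\<dots> = \<sigma> * \<rho> + \<sigma> * \<rho> / n + x * \<rho> * \<Delta> + x * (c * \<rho>\<^sup>2 / 2)"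
    by (simp add: x_def power2_eq_square algebra_simps add_divide_distrib)
  also have "\<dots> \<le> \<sigma> * \<rho> + c * L / n + 3 / 2 * sqrt L * \<Delta> + 3 / 2 * (c * L / n)"
  proof (intro add_mono)
    show "\<sigma> * \<rho> / n \<le> c * L / n"
      using n \<sigma> \<rho>s sL \<rho>0 c by (intro divide_right_mono mult_mono) auto
    show "x * \<rho> * \<Delta> \<le> 3 / 2 * sqrt L * \<Delta>"
      using x \<rho>s \<rho>0 \<Delta> by (intro mult_right_mono mult_mono) auto
    show "x * (c * \<rho>\<^sup>2 / 2) \<le> 3 / 2 * (c * L / n)"
      unfolding \<rho>2 using x c L n by (intro mult_mono) auto
  qed simp
  finally have "v * \<rho> \<le> \<sigma> * \<rho> + 3 / 2 * sqrt L * \<Delta> + 5 / 2 * (c * L / n)" by (simp add: mult.commute)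
  moreover have "8 * c * L / (3 * (n - 1)) \<le> 16 / 3 * (c * L / n)"
  proof -
    have "8 * c * L / (3 * (n - 1)) \<le> 8 * c * L / (3 * (n / 2))"
      using n c L by (intro divide_left_mono) auto
    then show ?thesis by simp
  qed
  moreover have "\<Delta> \<le> sqrt L * \<Delta>" using sL \<Delta> mult_right_mono[of 1 "sqrt L" \<Delta>] by simp
  moreover have "0 \<le> c * L / n" "0 \<le> sqrt L * \<Delta>" using c L n \<Delta> by auto
  moreover have "10 * c * L / n = 10 * (c * L / n)" "3 * sqrt L * \<Delta> = 3 * (sqrt L * \<Delta>)"
    "3 / 2 * sqrt L * \<Delta> = 3 / 2 * (sqrt L * \<Delta>)" by simp_all
  ultimately show ?thesis by argo
qed

lemma square_dev_sub_mean_le: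
  fixes q a b x m :: real
  assumes "x \<in> {a..b}" "m \<in> {a..b}"
  shows "(x - m)\<^sup>2 \<le> (max (m - a) (b - m))\<^sup>2"
  using assms by (intro abs_le_square_iff[THEN iffD1]) auto

text \<open>The deterministic half: \<open>mean\<close>, \<open>low\<close> and \<open>up\<close>
  are what holds outside the tail events. They use squared deviations from a fixed \<open>m\<close>,
  so that these can form an independent sum; subtracting \<open>n * d\<^sup>2\<close> recovers the
  empirical sum of squares.\<close>

lemma empirical_bernstein_pointwise:
  fixes x :: "'i \<Rightarrow> real" and m q c \<sigma> \<tau> \<Delta> L :: real
  assumes card: "2 \<le> card I"
  defines "n \<equiv> real (card I)"
  defines "xbar \<equiv> (\<Sum>i\<in>I. x i) / n"
  defines "\<rho> \<equiv> sqrt (2 * L / n)"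
  defines "psi \<equiv> sqrt ((\<Sum>i\<in>I. (x i - xbar)\<^sup>2) / (n - 1)) * \<rho> + 8 * c * L / (3 * (n - 1))"
  assumes c: "0 < c" and q: "q \<le> c" and L: "1 \<le> L" and \<Delta>: "0 \<le> \<Delta>"
    and \<sigma>: "0 \<le> \<sigma>" "\<sigma> \<le> \<tau>" and \<tau>: "\<tau> \<le> c" "\<tau> \<le> \<sigma> + \<Delta>" "\<tau>\<^sup>2 \<le> q * (c - q)"
    and mean: "\<bar>xbar - m\<bar> \<le> \<sigma> * \<rho> + c * \<rho>\<^sup>2 / 6"
    and low: "n * (\<tau>\<^sup>2 - q * \<tau> * \<rho>) \<le> (\<Sum>i\<in>I. (x i - m)\<^sup>2)"
    and up: "(\<Sum>i\<in>I. (x i - m)\<^sup>2) \<le> n * (\<tau> + c * \<rho> / 2)\<^sup>2"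
  shows "\<bar>xbar - m\<bar> \<le> psi" and "\<Delta> + psi \<le> 3 * sqrt L * \<Delta> + \<sigma> * \<rho> + 10 * c * L / n"
proof -
  have n: "2 \<le> n" using card by (simp add: n_def)
  have \<rho>: "0 \<le> \<rho>" and L': "L = n * \<rho>\<^sup>2 / 2" using L n by (auto simp: \<rho>_def)
  define d where "d = \<bar>xbar - m\<bar>"
  define v where "v = sqrt ((\<Sum>i\<in>I. (x i - xbar)\<^sup>2) / (n - 1))"
  have psi: "psi = v * \<rho> + 8 * c * L / (3 * (n - 1))"
    by (simp add: psi_def v_def)
  have v0: "0 \<le> v" using n by (simp add: v_def sum_nonneg)
  have xsum: "(\<Sum>i\<in>I. x i) = n * xbar" using n by (simp add: xbar_def)
  have "(n - 1) * v\<^sup>2 = (\<Sum>i\<in>I. (x i - xbar)\<^sup>2)" using n by (simp add: v_def sum_nonneg)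
  also have "\<dots> = (\<Sum>i\<in>I. (x i - m)\<^sup>2 - 2 * (xbar - m) * (x i - m) + (xbar - m)\<^sup>2)"
    by (intro sum.cong) (auto simp: power2_eq_square algebra_simps)
  also have "\<dots> = (\<Sum>i\<in>I. (x i - m)\<^sup>2) - 2 * (xbar - m) * (\<Sum>i\<in>I. x i - m) + n * (xbar - m)\<^sup>2"
    unfolding sum.distrib sum_subtractf sum_distrib_left[symmetric] by (simp add: n_def)
  also have "(\<Sum>i\<in>I. x i - m) = n * (xbar - m)"
    unfolding sum_subtractf xsum by (simp add: n_def algebra_simps)
  finally have vd: "(n - 1) * v\<^sup>2 = (\<Sum>i\<in>I. (x i - m)\<^sup>2) - n * d\<^sup>2"
    by (simp add: d_def power2_eq_square algebra_simps)
  have "\<tau>\<^sup>2 - q * \<tau> * \<rho> - d\<^sup>2 \<le> v\<^sup>2"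
  proof -
    have "n * (\<tau>\<^sup>2 - q * \<tau> * \<rho> - d\<^sup>2) \<le> (n - 1) * v\<^sup>2"
      using low unfolding vd by (simp add: algebra_simps)
    also have "\<dots> \<le> n * v\<^sup>2" by (intro mult_right_mono) auto
    finally show ?thesis using n by simp
  qed
  then have "\<sigma> \<le> v + 7 / 6 * c * \<rho>"
    using std_le_empirical_std[OF c q \<rho> v0 _ \<sigma> \<tau>(3) mean] by (simp add: d_def)
  then have "\<sigma> * \<rho> \<le> (v + 7 / 6 * c * \<rho>) * \<rho>" using \<rho> by (intro mult_right_mono)
  with mean have "d \<le> v * \<rho> + 4 / 3 * c * \<rho>\<^sup>2"
    unfolding d_def by (simp add: power2_eq_square algebra_simps)
  \<comment> \<open>The 4/3 is 7/6 from the standard deviation plus 1/6 from Bernstein's linear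
    term; since \<open>c * \<rho>\<^sup>2 = 2 * c * L / n\<close>, it becomes the 8/3 of the
    radius.\<close>
  also have "4 / 3 * c * \<rho>\<^sup>2 = 8 * c * L / (3 * n)"
    unfolding L' using n by simp
  also have "\<dots> \<le> 8 * c * L / (3 * (n - 1))" using n c L by (intro divide_left_mono) auto
  finally show "\<bar>xbar - m\<bar> \<le> psi" unfolding psi d_def by simp
  have "0 \<le> n * d\<^sup>2" using n by simp
  then have "(n - 1) * v\<^sup>2 \<le> n * (\<tau> + c * \<rho> / 2)\<^sup>2"
    using up unfolding vd by linarith
  moreover have "\<sigma> \<le> c" "0 \<le> \<tau>" using \<sigma> \<tau> by linarith+
  ultimately show "\<Delta> + psi \<le> 3 * sqrt L * \<Delta> + \<sigma> * \<rho> + 10 * c * L / n"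
    unfolding psi using empirical_bernstein_radius_le[OF n c L \<rho>_def[THEN meta_eq_to_obj_eq]] \<sigma> \<Delta> \<tau> by blast
qed

section \<open>Empirical Bernstein bound for one window\<close>

context prob_space
begin

text \<open>The summands may have different means; closeness to a common reference \<open>y\<close>
  limits by how much the second moment about the pooled mean exceeds the variance. Four tail events
  are discarded, and the pointwise lemma covers the rest.\<close>

lemma empirical_bernstein:
  fixes X :: "'i \<Rightarrow> 'a \<Rightarrow> real"
  assumes fin: "finite I"
    and indep: "indep_vars (\<lambda>_. borel) X I"
    and bd: "\<And>i. i \<in> I \<Longrightarrow> AE x in M. X i x \<in> {a..b}"
    and ab: "a < b" and L: "1 \<le> L"
    and near: "\<And>i. i \<in> I \<Longrightarrow> \<bar>expectation (X i) - y\<bar> \<le> \<Delta>"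
    and card: "2 \<le> card I"
  defines "n \<equiv> real (card I)"
  defines "m \<equiv> (\<Sum>i\<in>I. expectation (X i)) / n"
  defines "s2 \<equiv> (\<Sum>i\<in>I. variance (X i)) / n"
  defines "Xbar \<equiv> (\<lambda>x. (\<Sum>i\<in>I. X i x) / n)"
  defines "psi \<equiv> (\<lambda>x. sqrt ((\<Sum>i\<in>I. (X i x - Xbar x)\<^sup>2) / (n - 1)) * sqrt (2 * L / n)
    + 8 * (b - a) * L / (3 * (n - 1)))"
  shows "\<exists>E\<in>events. 1 - 4 * exp (- L) \<le> prob E \<and> (\<forall>x\<in>E. \<bar>Xbar x - m\<bar> \<le> psi x \<and>
    \<Delta> + psi x \<le> 3 * sqrt L * \<Delta> + sqrt s2 * sqrt (2 * L / n) + 10 * (b - a) * L / n)"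
proof -
  have rv [measurable]: "random_variable borel (X i)" if "i \<in> I" for i
    using indep that unfolding indep_vars_def by blast
  have n: "2 \<le> n" using card by (simp add: n_def)
  have ne: "I \<noteq> {}" using card by auto
  define c where "c = b - a"
  have c: "0 < c" using ab by (simp add: c_def)
  let ?m = "\<lambda>i. expectation (X i)"
  have int1: "integrable M (X i)" if "i \<in> I" for i
  proof (rule integrable_const_bound[where B = "max \<bar>a\<bar> \<bar>b\<bar>"])
    show "AE x in M. norm (X i x) \<le> max \<bar>a\<bar> \<bar>b\<bar>"
      using bd[OF that] by eventually_elim auto
  qed (rule rv[OF that])
  have int2: "integrable M (\<lambda>x. (X i x)\<^sup>2)" if i: "i \<in> I" for i
  proof (rule integrable_const_bound[where B = "(max \<bar>a\<bar> \<bar>b\<bar>)\<^sup>2"])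
    show "AE x in M. norm ((X i x)\<^sup>2) \<le> (max \<bar>a\<bar> \<bar>b\<bar>)\<^sup>2"
      using bd[OF i] by eventually_elim (auto simp: abs_le_square_iff[symmetric])
  qed (use rv[OF i] in measurable)
  have mi: "?m i \<in> {a..b}" if i: "i \<in> I" for i
  proof -
    have "AE x in M. a \<le> X i x" "AE x in M. X i x \<le> b"
      by (rule eventually_mono[OF bd[OF i]]; simp)+
    then have "a \<le> ?m i" "?m i \<le> b" using int1[OF i]
      by (auto intro: integral_ge_const integral_le_const)
    then show ?thesis by simp
  qed
  have msum: "(\<Sum>i\<in>I. ?m i) = n * m" using n by (simp add: m_def)
  have "m \<in> {a..b}"
  proof -
    have "(\<Sum>i\<in>I. a) \<le> (\<Sum>i\<in>I. ?m i)" "(\<Sum>i\<in>I. ?m i) \<le> (\<Sum>i\<in>I. b)"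
      using mi by (intro sum_mono; simp)+
    then have "n * a \<le> n * m" "n * m \<le> n * b" unfolding msum by (auto simp: n_def)
    then show ?thesis using n by simp
  qed
  note m = this
  \<comment> \<open>\<open>q\<^sup>2\<close> is a sharper bound on the squared deviations than
    \<open>c\<^sup>2\<close>; the lower tail relies on it.\<close>
  define q where "q = max (m - a) (b - m)"
  have q: "q \<le> c" "0 < q" using m ab by (auto simp: q_def c_def)
  define Y where "Y = (\<lambda>i x. (X i x - m)\<^sup>2)"
  have Ybd: "AE x in M. 0 \<le> Y i x \<and> Y i x \<le> q\<^sup>2" if i: "i \<in> I" for i
    using bd[OF i] by eventually_elim (use m in \<open>auto simp: Y_def q_def intro!: square_dev_sub_mean_le\<close>)
  have EY: "expectation (Y i) = variance (X i) + (?m i - m)\<^sup>2" if i: "i \<in> I" for i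
    using int1[OF i] int2[OF i]
    by (simp add: Y_def variance_eq power2_diff prob_space) (simp add: power2_eq_square algebra_simps)
  have intY: "integrable M (Y i)" if i: "i \<in> I" for i
    using int1[OF i] int2[OF i] by (simp add: Y_def power2_diff)
  define S where "S = (\<Sum>i\<in>I. expectation (Y i))"
  define W where "W = (\<Sum>i\<in>I. variance (X i))"
  have W0: "0 \<le> W" unfolding W_def by (intro sum_nonneg variance_positive)
  have SW: "S = W + (\<Sum>i\<in>I. (?m i - m)\<^sup>2)"
    unfolding S_def W_def by (simp add: EY sum.distrib)
  have WS: "W \<le> S" unfolding SW by (simp add: sum_nonneg)
  \<comment> \<open>The average minimises the sum of squared distances, so the spread of the means
    about \<open>m\<close> is at most that about \<open>y\<close>.\<close>
  have SD: "S \<le> W + n * \<Delta>\<^sup>2"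
  proof -
    have "(\<Sum>i\<in>I. (?m i - y)\<^sup>2) = (\<Sum>i\<in>I. (?m i - m)\<^sup>2 + 2 * (m - y) * (?m i - m) + (m - y)\<^sup>2)"
      by (intro sum.cong) (auto simp: power2_eq_square algebra_simps)
    also have "\<dots> = (\<Sum>i\<in>I. (?m i - m)\<^sup>2) + 2 * (m - y) * (\<Sum>i\<in>I. ?m i - m) + n * (m - y)\<^sup>2"
      by (simp add: sum.distrib sum_distrib_left n_def)
    also have "(\<Sum>i\<in>I. ?m i - m) = 0" by (simp add: sum_subtractf msum n_def)
    finally have "(\<Sum>i\<in>I. (?m i - m)\<^sup>2) \<le> (\<Sum>i\<in>I. (?m i - y)\<^sup>2)" using n by simp
    also have "\<dots> \<le> (\<Sum>i\<in>I. \<Delta>\<^sup>2)"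
      using near by (intro sum_mono abs_le_square_iff[THEN iffD1]) (meson abs_ge_self order_trans)
    finally show ?thesis unfolding SW by (simp add: n_def)
  qed
  \<comment> \<open>The Bhatia-Davis argument: \<open>(X i x - a) * (b - X i x) \<ge> 0\<close>
    bounds the squared deviation by an affine function of \<open>X i x\<close>, whose expectation
    averages to \<open>(m - a) * (b - m)\<close>.\<close>
  have Sq: "S \<le> n * (q * (c - q))"
  proof -
    have le: "expectation (Y i) \<le> (a + b - 2 * m) * ?m i + (m\<^sup>2 - a * b)" if i: "i \<in> I" for i
    proof -
      have "expectation (Y i) \<le> expectation (\<lambda>x. (a + b - 2 * m) * X i x + (m\<^sup>2 - a * b))"
      proof (rule integral_mono_AE[OF intY[OF i]])
        show "AE x in M. Y i x \<le> (a + b - 2 * m) * X i x + (m\<^sup>2 - a * b)"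
          using bd[OF i]
        proof eventually_elim
          case (elim x)
          then have "0 \<le> (X i x - a) * (b - X i x)" by simp
          then show ?case by (simp add: Y_def power2_eq_square algebra_simps)
        qed
      qed (use int1[OF i] in simp)
      also have "\<dots> = (a + b - 2 * m) * ?m i + (m\<^sup>2 - a * b)"
        using int1[OF i] by (simp add: prob_space)
      finally show ?thesis .
    qed
    have "S \<le> (\<Sum>i\<in>I. (a + b - 2 * m) * ?m i + (m\<^sup>2 - a * b))"
      unfolding S_def by (intro sum_mono le)
    also have "\<dots> = (a + b - 2 * m) * (n * m) + n * (m\<^sup>2 - a * b)"
      by (simp add: sum.distrib sum_distrib_left[symmetric] msum n_def)
    also have "\<dots> = n * ((m - a) * (b - m))" by (simp add: power2_eq_square algebra_simps)
    also have "(m - a) * (b - m) = q * (c - q)" by (auto simp: q_def c_def max_def)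
    finally show ?thesis .
  qed
  define \<sigma> \<tau> \<rho> where "\<sigma> = sqrt (W / n)" and "\<tau> = sqrt (S / n)" and "\<rho> = sqrt (2 * L / n)"
  have S0: "0 \<le> S" using W0 WS by linarith
  have sq: "W = n * \<sigma>\<^sup>2" "S = n * \<tau>\<^sup>2" "2 * L = n * \<rho>\<^sup>2" and nonneg: "0 \<le> \<sigma>" "0 \<le> \<tau>" "0 \<le> \<rho>"
    using n W0 S0 L by (auto simp: \<sigma>_def \<tau>_def \<rho>_def)
  have L': "L = n * \<rho>\<^sup>2 / 2" using sq by simp
  have \<Delta>: "0 \<le> \<Delta>" using near ne by (metis abs_ge_zero ex_in_conv order_trans)
  have \<sigma>\<tau>: "\<sigma> \<le> \<tau>" unfolding \<sigma>_def \<tau>_def using WS n by (simp add: divide_right_mono)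
  have \<tau>q: "\<tau>\<^sup>2 \<le> q * (c - q)" using Sq n unfolding sq by simp
  have "\<tau>\<^sup>2 \<le> c\<^sup>2"
  proof -
    have "q * (c - q) \<le> c * c" using q c by (intro mult_mono) auto
    then show ?thesis using \<tau>q by (simp add: power2_eq_square)
  qed
  then have \<tau>c: "\<tau> \<le> c" by (rule power2_le_imp_le) (use c in simp)
  have \<tau>\<Delta>: "\<tau> \<le> \<sigma> + \<Delta>"
  proof (rule power2_le_imp_le)
    have "n * \<tau>\<^sup>2 \<le> n * (\<sigma>\<^sup>2 + \<Delta>\<^sup>2)" using SD unfolding sq by (simp add: algebra_simps)
    then have "\<tau>\<^sup>2 \<le> \<sigma>\<^sup>2 + \<Delta>\<^sup>2" using n by simp
    also have "\<dots> \<le> (\<sigma> + \<Delta>)\<^sup>2" using nonneg \<Delta> by (simp add: power2_sum)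
    finally show "\<tau>\<^sup>2 \<le> (\<sigma> + \<Delta>)\<^sup>2" .
  qed (use nonneg \<Delta> in auto)

  define F1 where "F1 = {x \<in> space M. (\<Sum>i\<in>I. X i x - ?m i) \<ge> sqrt (2 * W * L) + c * L / 3}"
  define F2 where "F2 = {x \<in> space M. (\<Sum>i\<in>I. ?m i - X i x) \<ge> sqrt (2 * W * L) + c * L / 3}"
  \<comment> \<open>The crude range \<open>c\<^sup>2\<close> suffices here: the upper tail enters
    only the oracle bound, whose constants have room.\<close>
  define F3 where "F3 = {x \<in> space M. (\<Sum>i\<in>I. Y i x - expectation (Y i))
    \<ge> sqrt (2 * (c\<^sup>2 * S) * L) + c\<^sup>2 * L / 3}"
  \<comment> \<open>The lower tail lemma asks for a positive total; for \<open>S = 0\<close> the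
    desired lower bound on the sum of squares is trivial, so nothing is discarded.\<close>
  define F4 where "F4 = (if S = 0 then {} else
    {x \<in> space M. (\<Sum>i\<in>I. Y i x) \<le> S - sqrt (2 * (q\<^sup>2 * S) * L)})"
  have L0: "0 < L" using L by simp
  have Xdev: "AE x in M. \<bar>X i x - ?m i\<bar> \<le> c" "AE x in M. \<bar>?m i - X i x\<bar> \<le> c" if i: "i \<in> I" for i
    by (rule eventually_mono[OF bd[OF i]]; use mi[OF i] in \<open>auto simp: c_def\<close>)+
  have F1: "prob F1 \<le> exp (- L)" unfolding F1_def
  proof (rule bernstein_ineq[OF fin _ Xdev(1) _ _ c L0])
    show "indep_vars (\<lambda>_. borel) (\<lambda>i x. X i x - ?m i) I"
      by (rule indep_vars_compose2[OF indep, of "\<lambda>i y. y - ?m i"]) auto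
  qed (auto simp: W_def int1 prob_space)
  have F2: "prob F2 \<le> exp (- L)" unfolding F2_def
  proof (rule bernstein_ineq[OF fin _ Xdev(2) _ _ c L0])
    show "indep_vars (\<lambda>_. borel) (\<lambda>i x. ?m i - X i x) I"
      by (rule indep_vars_compose2[OF indep, of "\<lambda>i y. ?m i - y"]) auto
  qed (auto simp: W_def int1 prob_space power2_commute)
  have indY: "indep_vars (\<lambda>_. borel) Y I"
    unfolding Y_def by (rule indep_vars_compose2[OF indep, of "\<lambda>i y. (y - m)\<^sup>2"]) auto
  have Yc: "AE x in M. 0 \<le> Y i x \<and> Y i x \<le> c\<^sup>2" if i: "i \<in> I" for i
  proof -
    have "q\<^sup>2 \<le> c\<^sup>2" using q by (intro power_mono) auto
    then show ?thesis by (intro eventually_mono[OF Ybd[OF i]]) auto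
  qed
  have F3: "prob F3 \<le> exp (- L)" unfolding F3_def
  proof (rule bernstein_ineq[OF fin _ _ _ _ _ L0])
    show "indep_vars (\<lambda>_. borel) (\<lambda>i x. Y i x - expectation (Y i)) I"
      by (rule indep_vars_compose2[OF indY, of "\<lambda>i y. y - expectation (Y i)"]) auto
    fix i assume i: "i \<in> I"
    have "AE x in M. 0 \<le> Y i x" "AE x in M. Y i x \<le> c\<^sup>2"
      by (rule eventually_mono[OF Yc[OF i]]; simp)+
    then have EYc: "0 \<le> expectation (Y i)" "expectation (Y i) \<le> c\<^sup>2"
      using intY[OF i] by (auto intro: integral_ge_const integral_le_const)
    show "AE x in M. \<bar>Y i x - expectation (Y i)\<bar> \<le> c\<^sup>2"
      by (rule eventually_mono[OF Yc[OF i]]) (use EYc in auto)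
    show "expectation (\<lambda>x. Y i x - expectation (Y i)) = 0"
      using intY[OF i] by (simp add: prob_space)
  next
    \<comment> \<open>Since \<open>Y i x\<close> lies between 0 and \<open>c\<^sup>2\<close>, its
      variance is at most \<open>c\<^sup>2\<close> times its mean, which expresses Bernstein's
      variance factor through \<open>S\<close>.\<close>
    have "variance (Y i) \<le> c\<^sup>2 * expectation (Y i)" if i: "i \<in> I" for i
    proof -
      have i2: "integrable M (\<lambda>x. (Y i x)\<^sup>2)"
      proof (rule integrable_const_bound[where B = "(c\<^sup>2)\<^sup>2"])
        show "AE x in M. norm ((Y i x)\<^sup>2) \<le> (c\<^sup>2)\<^sup>2"
          using Yc[OF i] by eventually_elim (simp only: real_norm_def abs_power2, rule power_mono, auto)
        show "(\<lambda>x. (Y i x)\<^sup>2) \<in> borel_measurable M" unfolding Y_def using rv[OF i] by measurable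
      qed
      have "variance (Y i) \<le> expectation (\<lambda>x. (Y i x)\<^sup>2)"
        using variance_eq[OF intY[OF i] i2] by simp
      also have "\<dots> \<le> expectation (\<lambda>x. c\<^sup>2 * Y i x)"
      proof (rule integral_mono_AE[OF i2])
        show "AE x in M. (Y i x)\<^sup>2 \<le> c\<^sup>2 * Y i x"
          using Yc[OF i] by eventually_elim (auto simp: power2_eq_square[of "Y _ _"] intro: mult_right_mono)
      qed (use intY[OF i] in simp)
      finally show ?thesis by simp
    qed
    then show "(\<Sum>i\<in>I. variance (Y i)) \<le> c\<^sup>2 * S"
      unfolding S_def sum_distrib_left by (rule sum_mono)
  qed (use c in auto)
  have F4: "prob F4 \<le> exp (- L)"
  proof (cases "S = 0")
    case False
    then have "0 < S" using S0 by simp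
    from nonneg_sum_lower_tail[OF fin indY Ybd S_def this _ L0] q False
    show ?thesis by (simp add: F4_def)
  qed (simp add: F4_def)
  have [measurable]: "random_variable borel (Y i)" if "i \<in> I" for i
    using rv[OF that] unfolding Y_def by measurable
  have ev: "F1 \<in> events" "F2 \<in> events" "F3 \<in> events" "F4 \<in> events"
  proof -
    have "{x \<in> space M. (\<Sum>i\<in>I. Y i x) \<le> S - sqrt (2 * (q\<^sup>2 * S) * L)} \<in> events" by measurable
    then show "F4 \<in> events" by (simp add: F4_def)
  qed (unfold F1_def F2_def F3_def, measurable)
  define E where "E = space M - (F1 \<union> F2 \<union> F3 \<union> F4)"
  have "E \<in> events" unfolding E_def using ev by auto
  moreover have "1 - 4 * exp (- L) \<le> prob E"
  proof -
    have "prob (F1 \<union> F2 \<union> F3 \<union> F4) \<le> prob F1 + prob F2 + prob F3 + prob F4"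
    proof -
      have "prob (F1 \<union> F2) \<le> prob F1 + prob F2"
        "prob (F1 \<union> F2 \<union> F3) \<le> prob (F1 \<union> F2) + prob F3"
        "prob (F1 \<union> F2 \<union> F3 \<union> F4) \<le> prob (F1 \<union> F2 \<union> F3) + prob F4"
        using ev by (auto intro!: measure_Un_le)
      then show ?thesis by linarith
    qed
    moreover have "prob E = 1 - prob (F1 \<union> F2 \<union> F3 \<union> F4)"
      unfolding E_def using ev by (intro prob_compl) auto
    ultimately show ?thesis using F1 F2 F3 F4 by linarith
  qed
  moreover have "\<bar>Xbar x - m\<bar> \<le> psi x \<and>
    \<Delta> + psi x \<le> 3 * sqrt L * \<Delta> + sqrt s2 * sqrt (2 * L / n) + 10 * (b - a) * L / n"
    if x: "x \<in> E" for x
  proof -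
    have Xsum: "(\<Sum>i\<in>I. X i x) = n * Xbar x" using n by (simp add: Xbar_def)
    \<comment> \<open>The choices \<open>k = 1\<close>, \<open>k = q\<close> and
      \<open>k = c\<close> evaluate the thresholds for the mean, the lower tail and the upper
      tail.\<close>
    have root: "sqrt (2 * (k\<^sup>2 * (n * s\<^sup>2)) * L) = n * (k * s * \<rho>)" if "0 \<le> k" "0 \<le> s" for k s
      by (rule real_sqrt_unique) (use that nonneg n in \<open>auto simp: L' power2_eq_square\<close>)
    have xs: "x \<in> space M" "x \<notin> F1" "x \<notin> F2" "x \<notin> F3" "x \<notin> F4" using x by (auto simp: E_def)
    have "(\<Sum>i\<in>I. X i x - ?m i) = n * (Xbar x - m)"
      by (simp add: sum_subtractf msum Xsum algebra_simps)
    moreover have "(\<Sum>i\<in>I. ?m i - X i x) = n * (m - Xbar x)"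
      by (simp add: sum_subtractf msum Xsum algebra_simps)
    moreover have "sqrt (2 * W * L) + c * L / 3 = n * (\<sigma> * \<rho> + c * \<rho>\<^sup>2 / 6)"
      using root[of 1 \<sigma>] nonneg by (simp add: sq(1)) (simp add: L' algebra_simps)
    ultimately have "n * (Xbar x - m) \<le> n * (\<sigma> * \<rho> + c * \<rho>\<^sup>2 / 6)"
      "n * (m - Xbar x) \<le> n * (\<sigma> * \<rho> + c * \<rho>\<^sup>2 / 6)"
      using xs unfolding F1_def F2_def by auto
    then have mean: "\<bar>Xbar x - m\<bar> \<le> \<sigma> * \<rho> + c * \<rho>\<^sup>2 / 6" using n by (simp add: abs_le_iff)
    have low: "n * (\<tau>\<^sup>2 - q * \<tau> * \<rho>) \<le> (\<Sum>i\<in>I. Y i x)"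
    proof (cases "S = 0")
      case True
      then have "\<tau> = 0" by (simp add: \<tau>_def)
      then show ?thesis by (simp add: Y_def sum_nonneg)
    next
      case False
      then show ?thesis using xs root[of q \<tau>] q nonneg
        by (simp add: F4_def sq(2)) (simp add: algebra_simps)
    qed
    have up: "(\<Sum>i\<in>I. Y i x) \<le> n * (\<tau> + c * \<rho> / 2)\<^sup>2"
    proof -
      have "(\<Sum>i\<in>I. Y i x) \<le> n * \<tau>\<^sup>2 + n * (c * \<tau> * \<rho>) + c\<^sup>2 * L / 3"
        using xs root[of c \<tau>] c nonneg
        by (simp add: F3_def sum_subtractf S_def[symmetric] sq(2))
      also have "\<dots> = n * (\<tau>\<^sup>2 + c * \<tau> * \<rho> + c\<^sup>2 * \<rho>\<^sup>2 / 6)" by (simp add: L' algebra_simps)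
      \<comment> \<open>Rounding 1/6 up to 1/4 completes the square.\<close>
      also have "\<dots> \<le> n * (\<tau>\<^sup>2 + c * \<tau> * \<rho> + c\<^sup>2 * \<rho>\<^sup>2 / 4)" using n by (intro mult_left_mono) auto
      also have "\<dots> = n * (\<tau> + c * \<rho> / 2)\<^sup>2" by (simp add: power2_eq_square algebra_simps)
      finally show ?thesis .
    qed
    show ?thesis
      using empirical_bernstein_pointwise[OF card c q(1) L \<Delta> nonneg(1) \<sigma>\<tau> \<tau>c \<tau>\<Delta> \<tau>q,
          where x = "\<lambda>i. X i x" and m = m] mean low up
      unfolding psi_def Xbar_def \<rho>_def \<sigma>_def W_def s2_def c_def Y_def n_def by blast
  qed
  ultimately show ?thesis by blast
qed

text \<open>Adds the windows with a single sample, where the radius is the full range: the sample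
  almost surely lies in \<open>{a..b}\<close>, as does its mean, and \<open>10 * (b - a) * L\<close>
  covers \<open>b - a\<close> because \<open>L \<ge> 1\<close>.\<close>

lemma empirical_bernstein_window:
  fixes X :: "'i \<Rightarrow> 'a \<Rightarrow> real"
  assumes fin: "finite I" and ne: "I \<noteq> {}"
    and indep: "indep_vars (\<lambda>_. borel) X I"
    and bd: "\<And>i. i \<in> I \<Longrightarrow> AE x in M. X i x \<in> {a..b}"
    and ab: "a < b" and L: "1 \<le> L"
    and near: "\<And>i. i \<in> I \<Longrightarrow> \<bar>expectation (X i) - y\<bar> \<le> \<Delta>"
  defines "n \<equiv> real (card I)"
  defines "m \<equiv> (\<Sum>i\<in>I. expectation (X i)) / n"
  defines "s2 \<equiv> (\<Sum>i\<in>I. variance (X i)) / n"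
  defines "Xbar \<equiv> (\<lambda>x. (\<Sum>i\<in>I. X i x) / n)"
  defines "psi \<equiv> (\<lambda>x. if card I = 1 then b - a else
    sqrt ((\<Sum>i\<in>I. (X i x - Xbar x)\<^sup>2) / (n - 1)) * sqrt (2 * L / n)
    + 8 * (b - a) * L / (3 * (n - 1)))"
  shows "\<exists>E\<in>events. 1 - 4 * exp (- L) \<le> prob E \<and> (\<forall>x\<in>E. \<bar>Xbar x - m\<bar> \<le> psi x \<and>
    \<Delta> + psi x \<le> 3 * sqrt L * \<Delta> + sqrt s2 * sqrt (2 * L / n) + 10 * (b - a) * L / n)"
proof (cases "card I = 1")
  case False
  moreover have "card I \<noteq> 0" using fin ne by simp
  ultimately have "2 \<le> card I" by linarith
  from empirical_bernstein[OF fin indep bd ab L near this] False show ?thesis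
    unfolding n_def m_def s2_def Xbar_def psi_def by simp
next
  case True
  then obtain i where I: "I = {i}" by (auto simp: card_1_singleton_iff)
  have [measurable]: "random_variable borel (X i)"
    using indep unfolding indep_vars_def I by blast
  have bdi: "AE x in M. X i x \<in> {a..b}" using bd I by simp
  have int: "integrable M (X i)"
  proof (rule integrable_const_bound[where B = "max \<bar>a\<bar> \<bar>b\<bar>"])
    show "AE x in M. norm (X i x) \<le> max \<bar>a\<bar> \<bar>b\<bar>"
      using bdi by eventually_elim auto
  qed simp
  have "AE x in M. a \<le> X i x" "AE x in M. X i x \<le> b"
    by (rule eventually_mono[OF bdi]; simp)+
  then have mi: "a \<le> expectation (X i)" "expectation (X i) \<le> b"
    using int by (auto intro: integral_ge_const integral_le_const)
  define E where "E = {x \<in> space M. X i x \<in> {a..b}}"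
  have "E \<in> events" unfolding E_def by measurable
  moreover have "1 - 4 * exp (- L) \<le> prob E"
    using bdi prob_Collect_eq_1[of "\<lambda>x. X i x \<in> {a..b}"] \<open>E \<in> events\<close> by (simp add: E_def)
  moreover have "\<bar>Xbar x - m\<bar> \<le> psi x \<and>
    \<Delta> + psi x \<le> 3 * sqrt L * \<Delta> + sqrt s2 * sqrt (2 * L / n) + 10 * (b - a) * L / n"
    if x: "x \<in> E" for x
  proof -
    have \<Delta>: "0 \<le> \<Delta>" using near[of i] I by (auto intro: order_trans[OF abs_ge_zero])
    have "0 \<le> variance (X i)" by (rule variance_positive)
    then have "0 \<le> sqrt s2 * sqrt (2 * L / n)"
      using L by (simp add: s2_def n_def I)
    moreover have "1 * \<Delta> \<le> 3 * sqrt L * \<Delta>"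
      using real_sqrt_ge_one[OF L] by (intro mult_right_mono \<Delta>) linarith
    moreover have "(b - a) * 1 \<le> 10 * (b - a) * L"
      using ab L by (intro mult_mono) auto
    ultimately show ?thesis using x mi I
      by (auto simp: Xbar_def m_def psi_def n_def E_def abs_le_iff)
  qed
  ultimately show ?thesis by blast
qed

end

section \<open>Oracle inequality for the selected window\<close>

text \<open>Lepski's argument. Under \<open>dev\<close>, a disagreement with a shorter window beyond
  the radii can only come from bias, so \<open>phihat\<close> is an observable substitute for the
  unknown bias, and minimising its sum with \<open>psihat\<close> imitates the best
  trade-off.\<close>

lemma arw_oracle_inequality:
  fixes B :: "nat \<Rightarrow> nat" and x :: "nat \<Rightarrow> nat \<Rightarrow> real" and t :: nat
    and \<mu> D :: "nat \<Rightarrow> real" and y M \<delta> :: real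
  defines "\<psi> \<equiv> psihat B x \<delta> M t"
  assumes dev: "\<And>k. k \<in> {1..t} \<Longrightarrow> \<bar>muhat B x t k - \<mu> k\<bar> \<le> \<psi> k"
    and bias: "\<And>k. k \<in> {1..t} \<Longrightarrow> \<bar>\<mu> k - y\<bar> \<le> D k"
    and mono: "\<And>i k. 1 \<le> i \<Longrightarrow> i \<le> k \<Longrightarrow> k \<le> t \<Longrightarrow> D i \<le> D k"
    and khat: "khat \<in> arw_argmin B x \<delta> M t" and k: "k \<in> {1..t}"
  shows "\<bar>muhat B x t khat - y\<bar> \<le> 3 * (D k + \<psi> k)"
proof -
  let ?\<phi> = "phihat B x \<delta> M t" and ?m = "muhat B x t"
  have kh: "khat \<in> {1..t}" and opt: "?\<phi> khat + \<psi> khat \<le> ?\<phi> k + \<psi> k"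
    using khat k by (auto simp: arw_argmin_def \<psi>_def)
  have \<phi>_ge: "0 \<le> ?\<phi> l" "\<bar>?m l - ?m i\<bar> - (\<psi> l + \<psi> i) \<le> ?\<phi> l" if "i \<in> {1..l}" for i l
  proof -
    let ?f = "\<lambda>i. max 0 (\<bar>?m l - ?m i\<bar> - (\<psi> l + \<psi> i))"
    have "?f i \<le> ?\<phi> l" unfolding phihat_def \<psi>_def using that by (intro Max_ge) auto
    then show "0 \<le> ?\<phi> l" "\<bar>?m l - ?m i\<bar> - (\<psi> l + \<psi> i) \<le> ?\<phi> l" by simp_all
  qed
  have D0: "0 \<le> D k" using bias[OF k] by linarith
  \<comment> \<open>For \<open>i \<le> k\<close> the empirical means differ beyond their radii by at
    most \<open>D i + D k\<close>, and monotonicity replaces \<open>D i\<close> by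
    \<open>D k\<close>.\<close>
  have \<phi>_le: "?\<phi> k \<le> 2 * D k"
    unfolding phihat_def \<psi>_def[symmetric]
  proof (rule Max.boundedI)
    fix z assume "z \<in> (\<lambda>i. max 0 (\<bar>?m k - ?m i\<bar> - (\<psi> k + \<psi> i))) ` {1..k}"
    then obtain i where i: "i \<in> {1..k}" and z: "z = max 0 (\<bar>?m k - ?m i\<bar> - (\<psi> k + \<psi> i))" by blast
    have i': "i \<in> {1..t}" and "D i \<le> D k" using i k mono by auto
    then show "z \<le> 2 * D k" using dev[OF k] dev[OF i'] bias[OF k] bias[OF i'] D0 z by linarith
  qed (use k in auto)
  show ?thesis
  proof (cases "k \<le> khat")
    \<comment> \<open>A longer selected window is compared with \<open>k\<close> through its own
      \<open>phihat\<close>; minimality and the triangle inequality through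
      \<open>muhat B x t k\<close> give \<open>3 * D k + 3 * \<psi> k\<close>.\<close>
    case True
    then show ?thesis using \<phi>_ge(2)[of k khat] opt \<phi>_le dev[OF k] bias[OF k] k by auto
  next
    \<comment> \<open>A shorter selected window has bias at most \<open>D k\<close> by monotonicity,
      and minimality bounds its radius. This gives \<open>3 * D k + \<psi> k\<close>, which is
      enough as \<open>dev\<close> forces \<open>\<psi> k \<ge> 0\<close>.\<close>
    case False
    then have "D khat \<le> D k" using mono kh k by simp
    then show ?thesis using \<phi>_ge(1)[of khat khat] opt \<phi>_le dev[OF kh] bias[OF kh] dev[OF k] kh by auto
  qed
qed

section \<open>Transfer to the data model and union bound over windows\<close>

theorem mainTheorem6:
  fixes M :: "'w measure"
    and Q :: "nat \<Rightarrow> real measure"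
    and u :: "nat \<Rightarrow> nat \<Rightarrow> 'w \<Rightarrow> real"
    and B :: "nat \<Rightarrow> nat"
    and a b \<delta> :: real
    and t :: nat
  assumes "prob_space M"
    and "a < b"
    and "t \<ge> 1"
    and "\<delta> > 0" and "\<delta> < 1"
    and "\<And>j. j \<in> {1..t} \<Longrightarrow> B j \<ge> 1"
    and "\<And>j. j \<in> {1..t} \<Longrightarrow> prob_space (Q j)"
    and "\<And>j. j \<in> {1..t} \<Longrightarrow> sets (Q j) = sets borel"
    and "\<And>j. j \<in> {1..t} \<Longrightarrow> measure (Q j) {a..b} = 1"
    and "prob_space.indep_vars M (\<lambda>_. borel) (\<lambda>(j, i). u j i)
           {(j, i). j \<in> {1..t} \<and> i \<in> {1..B j}}"
    and "\<And>j i. j \<in> {1..t} \<Longrightarrow> i \<in> {1..B j} \<Longrightarrow> distr M borel (u j i) = Q j"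
  shows
    "let \<mu> = (\<lambda>j. integral\<^sup>L (Q j) (\<lambda>y. y));
         s2 = (\<lambda>j. integral\<^sup>L (Q j) (\<lambda>y. (y - \<mu> j)\<^sup>2));
         L = ln (6 * real t / \<delta>);
         bound = 3 * Min ((\<lambda>k. 3 * sqrt L * Max ((\<lambda>j. \<bar>\<mu> j - \<mu> t\<bar>) ` {t-k+1..t})
                               + sqrt (sigma2tk B s2 t k) * sqrt (2 * L / real (Btk B t k))
                               + 10 * (b - a) * L / real (Btk B t k)) ` {1..t})
     in \<exists>E \<in> sets M. measure M E \<ge> 1 - \<delta> \<and>
          (\<forall>\<omega> \<in> E. \<forall>khat \<in> arw_argmin B (\<lambda>j i. u j i \<omega>) (\<delta> / (3 * real t)) (b - a) t.
              \<bar>muhat B (\<lambda>j i. u j i \<omega>) t khat - \<mu> t\<bar> \<le> bound)"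
proof -
  interpret prob_space M by fact
  define \<mu> where "\<mu> = (\<lambda>j. integral\<^sup>L (Q j) (\<lambda>y. y))"
  define s2 where "s2 = (\<lambda>j. integral\<^sup>L (Q j) (\<lambda>y. (y - \<mu> j)\<^sup>2))"
  define L where "L = ln (6 * real t / \<delta>)"
  define D where "D = (\<lambda>k. Max ((\<lambda>j. \<bar>\<mu> j - \<mu> t\<bar>) ` {t-k+1..t}))"
  define f where "f = (\<lambda>k. 3 * sqrt L * D k + sqrt (sigma2tk B s2 t k) * sqrt (2 * L / real (Btk B t k))
    + 10 * (b - a) * L / real (Btk B t k))"
  have L: "1 \<le> L"
  proof -
    have "real t * \<delta> \<le> real t" using \<open>\<delta> < 1\<close> mult_left_mono[of \<delta> 1 "real t"] by simp
    moreover have "\<delta> \<le> real t" using \<open>\<delta> < 1\<close> \<open>t \<ge> 1\<close> by simp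
    ultimately have "3 \<le> 6 * real t / \<delta>" using \<open>\<delta> > 0\<close> by (simp add: field_simps)
    then have "exp 1 \<le> 6 * real t / \<delta>" using exp_le by linarith
    then show ?thesis unfolding L_def using \<open>\<delta> > 0\<close> \<open>t \<ge> 1\<close> by (subst ln_ge_iff) auto
  qed
  have expL: "exp (- L) = \<delta> / (6 * real t)"
    using \<open>\<delta> > 0\<close> \<open>t \<ge> 1\<close> by (simp add: L_def exp_minus)
  \<comment> \<open>The choice of \<open>\<delta>'\<close> makes the logarithm in the radii equal to
    the one in the bound.\<close>
  have lnL: "ln (2 / (\<delta> / (3 * real t))) = L" by (simp add: L_def field_simps)
  define U where "U = (\<lambda>(j, i). u j i)"
  define J where "J = {(j, i). j \<in> {1..t} \<and> i \<in> {1..B j}}"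
  have ind: "indep_vars (\<lambda>_. borel) U J" using assms(10) by (simp add: U_def J_def)
  have rv: "random_variable borel (u j i)" if "j \<in> {1..t}" "i \<in> {1..B j}" for j i
    using ind that unfolding indep_vars_def U_def J_def by fastforce
  have bd: "AE x in M. u j i x \<in> {a..b}" if ji: "j \<in> {1..t}" "i \<in> {1..B j}" for j i
  proof -
    interpret Q: prob_space "Q j" by (rule assms(7)[OF ji(1)])
    have "AE y in Q j. y \<in> {a..b}" using assms(9)[OF ji(1)] by (rule Q.AE_prob_1)
    then have "AE y in distr M borel (u j i). y \<in> {a..b}" by (simp only: assms(11)[OF ji])
    then show ?thesis by (rule AE_distrD[OF rv[OF ji]])
  qed
  have mean: "expectation (u j i) = \<mu> j" if ji: "j \<in> {1..t}" "i \<in> {1..B j}" for j i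
    unfolding \<mu>_def assms(11)[OF ji, symmetric] by (rule integral_distr[symmetric, OF rv[OF ji]]) simp
  have var: "variance (u j i) = s2 j" if ji: "j \<in> {1..t}" "i \<in> {1..B j}" for j i
    unfolding s2_def mean[OF ji] assms(11)[OF ji, symmetric]
    by (rule integral_distr[symmetric, OF rv[OF ji]]) simp
  \<comment> \<open>A window is encoded as its set of (period, sample) pairs, so the bound for one
    pooled family of variables serves every window.\<close>
  define I where "I = (\<lambda>k. Sigma {t-k+1..t} (\<lambda>j. {1..B j}))"
  define \<nu> where "\<nu> = (\<lambda>k. (\<Sum>p\<in>I k. expectation (U p)) / real (card (I k)))"
  have IJ: "I k \<subseteq> J" for k by (auto simp: I_def J_def)
  have fin: "finite (I k)" for k by (simp add: I_def)
  have cardI: "card (I k) = Btk B t k" for k by (simp add: I_def Btk_def)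
  have ne: "I k \<noteq> {}" if "k \<in> {1..t}" for k
  proof -
    have "(t, 1) \<in> I k" using assms(6)[of t] that by (auto simp: I_def)
    then show ?thesis by blast
  qed
  have dev: "\<bar>\<mu> j - \<mu> t\<bar> \<le> D k" if "j \<in> {t-k+1..t}" for j k
    unfolding D_def using that by (intro Max_ge) auto
  have near: "\<bar>expectation (U p) - \<mu> t\<bar> \<le> D k" if "p \<in> I k" for p k
    using that dev by (auto simp: I_def U_def mean)
  let ?x = "\<lambda>\<omega> j i. u j i \<omega>" and ?\<delta>' = "\<delta> / (3 * real t)"
  have "\<exists>E\<in>events. 1 - 4 * exp (- L) \<le> prob E \<and> (\<forall>\<omega>\<in>E.
      \<bar>muhat B (?x \<omega>) t k - \<nu> k\<bar> \<le> psihat B (?x \<omega>) ?\<delta>' (b - a) t k \<and>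
      D k + psihat B (?x \<omega>) ?\<delta>' (b - a) t k \<le> f k)"
    if k: "k \<in> {1..t}" for k
  proof -
    have sum_I: "(\<Sum>p\<in>I k. g p) = (\<Sum>j\<in>{t-k+1..t}. \<Sum>i\<in>{1..B j}. g (j, i))" for g :: "_ \<Rightarrow> real"
      unfolding I_def by (subst sum.Sigma) auto
    have xbar: "(\<Sum>p\<in>I k. U p \<omega>) / real (card (I k)) = muhat B (?x \<omega>) t k" for \<omega>
      unfolding muhat_def cardI sum_I by (simp add: U_def)
    have psi: "(if card (I k) = 1 then b - a else
        sqrt ((\<Sum>p\<in>I k. (U p \<omega> - muhat B (?x \<omega>) t k)\<^sup>2) / (real (card (I k)) - 1))
          * sqrt (2 * L / real (card (I k)))
        + 8 * (b - a) * L / (3 * (real (card (I k)) - 1))) = psihat B (?x \<omega>) ?\<delta>' (b - a) t k" for \<omega>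
      unfolding psihat_def vhat_def lnL cardI sum_I by (simp add: U_def)
    have "(\<Sum>p\<in>I k. variance (U p)) = (\<Sum>j\<in>{t-k+1..t}. real (B j) * s2 j)"
      unfolding sum_I by (intro sum.cong) (auto simp: U_def var)
    then have s2: "(\<Sum>p\<in>I k. variance (U p)) / real (card (I k)) = sigma2tk B s2 t k"
      by (simp add: sigma2tk_def cardI)
    have nu: "(\<Sum>p\<in>I k. expectation (U p)) / real (card (I k)) = \<nu> k" by (simp add: \<nu>_def)
    have bdI: "AE x in M. U p x \<in> {a..b}" if "p \<in> I k" for p
      using that bd IJ by (auto simp: U_def I_def)
    show ?thesis
      using empirical_bernstein_window[OF fin ne[OF k] indep_vars_subset[OF ind IJ] bdI \<open>a < b\<close> L near[of _ k]]
      unfolding xbar unfolding psi s2 unfolding nu unfolding f_def cardI by blast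
  qed
  then obtain E where E: "\<And>k. k \<in> {1..t} \<Longrightarrow> E k \<in> events"
    "\<And>k. k \<in> {1..t} \<Longrightarrow> 1 - 4 * exp (- L) \<le> prob (E k)"
    and good: "\<And>k \<omega>. k \<in> {1..t} \<Longrightarrow> \<omega> \<in> E k \<Longrightarrow>
      \<bar>muhat B (?x \<omega>) t k - \<nu> k\<bar> \<le> psihat B (?x \<omega>) ?\<delta>' (b - a) t k \<and>
      D k + psihat B (?x \<omega>) ?\<delta>' (b - a) t k \<le> f k"
    by metis
  define G where "G = space M - (\<Union>k\<in>{1..t}. space M - E k)"
  have bad: "(\<Union>k\<in>{1..t}. space M - E k) \<in> events"
    using E by (intro sets.finite_UN sets.Diff) auto
  then have G: "G \<in> events" unfolding G_def by (rule sets.compl_sets)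
  have "prob (\<Union>k\<in>{1..t}. space M - E k) \<le> (\<Sum>k\<in>{1..t}. prob (space M - E k))"
    using E by (intro measure_UNION_le) auto
  also have "\<dots> \<le> (\<Sum>k\<in>{1..t}. 4 * exp (- L))"
  proof (rule sum_mono)
    fix k assume "k \<in> {1..t}"
    then show "prob (space M - E k) \<le> 4 * exp (- L)" using E[of k] by (simp add: prob_compl)
  qed
  \<comment> \<open>The sum is \<open>t * 4 * \<delta> / (6 * t)\<close>, that is, two thirds of
    \<open>\<delta>\<close>.\<close>
  also have "\<dots> \<le> \<delta>" using \<open>\<delta> > 0\<close> \<open>t \<ge> 1\<close> by (simp add: expL)
  finally have "1 - \<delta> \<le> prob G"
    unfolding G_def prob_compl[OF bad] by simp
  moreover have "\<bar>muhat B (?x \<omega>) t khat - \<mu> t\<bar> \<le> 3 * Min (f ` {1..t})"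
    if \<omega>: "\<omega> \<in> G" and khat: "khat \<in> arw_argmin B (?x \<omega>) ?\<delta>' (b - a) t" for \<omega> khat
  proof -
    have \<omega>E: "\<omega> \<in> E k" if "k \<in> {1..t}" for k using \<omega> that by (auto simp: G_def)
    \<comment> \<open>The pooled mean averages the period means with weights \<open>B j\<close>, so
      its bias is at most the largest bias of a period in the window.\<close>
    have bias: "\<bar>\<nu> k - \<mu> t\<bar> \<le> D k" if k: "k \<in> {1..t}" for k
    proof -
      have n: "0 < real (card (I k))" using fin ne[OF k] by (simp add: card_gt_0_iff)
      have "\<bar>\<Sum>p\<in>I k. expectation (U p) - \<mu> t\<bar> \<le> (\<Sum>p\<in>I k. D k)"
        by (rule order_trans[OF sum_abs]) (intro sum_mono near)
      moreover have "(\<Sum>p\<in>I k. expectation (U p) - \<mu> t) = real (card (I k)) * (\<nu> k - \<mu> t)"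
        using n by (simp add: sum_subtractf \<nu>_def algebra_simps)
      ultimately show ?thesis using n by (simp add: abs_mult)
    qed
    \<comment> \<open>The windows are nested, so a longer one takes the maximum over more
      periods.\<close>
    have mono: "D i \<le> D k" if "1 \<le> i" "i \<le> k" "k \<le> t" for i k
      unfolding D_def using that by (intro Max_mono image_mono) auto
    have "\<bar>muhat B (?x \<omega>) t khat - \<mu> t\<bar> \<le> 3 * f k" if k: "k \<in> {1..t}" for k
      using arw_oracle_inequality[OF _ bias mono khat k] good \<omega>E k by fastforce
    moreover have "Min (f ` {1..t}) \<in> f ` {1..t}" using \<open>t \<ge> 1\<close> by (intro Min_in) auto
    ultimately show ?thesis by auto
  qed
  ultimately have "\<exists>E\<in>events. 1 - \<delta> \<le> prob E \<and>
      (\<forall>\<omega>\<in>E. \<forall>khat\<in>arw_argmin B (?x \<omega>) ?\<delta>' (b - a) t.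
        \<bar>muhat B (?x \<omega>) t khat - \<mu> t\<bar> \<le> 3 * Min (f ` {1..t}))"
    using G by blast
  then show ?thesis unfolding Let_def f_def D_def L_def s2_def \<mu>_def .
qed

end
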